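(* Let $G=(V,E)$ be a simple connected graph with $n=|V|$, and let $\{V_1,V_2,V_3,V_4\}$ be a feasible tetrapartition of $V$ with $|V_1|\le|V_2|\le|V_3|\le|V_4|$ and $|V_4|>\frac25 n$, to which no Merge and no Pull operation is applicable, and such that $|V_2|+|V_3|\ge|V_4|$, $|V_4|<\frac12 n$, $|V_1|\le|V_2|<\frac16|V_4|<\frac1{12}n$, and $|V_3|>\frac13 n$. Suppose we are in Case 3: for some $i\in\{1,2\}$ and $j=3-i$, $V_i$ is adjacent to $V_3$ at the vertex $v\in V_3$ (every edge between $V_i$ and $V_3$ is incident to $v$) and $V_j$ is adjacent to $V_4$ at the vertex $u\in V_4$ (every edge between $V_j$ and $V_4$ is incident to $u$). Then: (a) letting $V'_3$ be the union of the vertex sets of all connected components of $G[(V_3\cup V_i)\setminus\{v\}]$ that are adjacent to $V_4$, if $|V'_3|\le|V_i|+\frac7{24}|V_4|$ then $|V_4|\le\frac{24}{13}\,\mathrm{OPT}$; (b) letting $V'_4$ be the union of the vertex sets of all connected components of $G[(V_4\cup V_j)\setminus\{u\}]$ that are adjacent to $V_3$, if $|V'_4|\le|V_j|+\frac{11}{24}|V_4|$ then $|V_4|\le\frac{24}{13}\,\mathrm{OPT}$.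
   Context: A feasible tetrapartition of $V$ is a partition into four non-empty parts each inducing a connected subgraph of $G$; $\mathrm{OPT}$ is the minimum, over all feasible tetrapartitions, of the largest part size. Two disjoint vertex sets are adjacent if some edge joins them. For a sorted feasible tetrapartition with $|V_4|>\frac25 n$: a Merge operation is applicable if there are distinct $i,j\in\{1,2,3\}$ with $V_i,V_j$ adjacent and $|V_i|+|V_j|<|V_4|$; a Pull operation is applicable if no Merge is applicable and there exist $(i,j)\in\{(1,3),(1,4),(2,3),(2,4),(3,4)\}$ and a non-empty proper subset $U\subset V_j$ with $G[U]$ and $G[V_j\setminus U]$ connected, $U$ adjacent to $V_i$, and $|V_i|+|U|<|V_j|$. *)

theory Defs
  imports Complex_Main "HOL-Library.Disjoint_Sets" "Graph_Theory.Graph_Theory"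
begin

text \<open>
  Finite simple undirected graphs are the symmetric, loop-free digraphs without parallel arcs
  of locale \<^locale>\<open>graph\<close>.  An edge between \<open>x\<close> and \<open>y\<close> is the pair of arcs
  \<open>x \<rightarrow> y\<close> and \<open>y \<rightarrow> x\<close>.
\<close>

text \<open>The library notion of connectedness excludes the graph without vertices.\<close>

definition connected_in :: "('a,'b) pre_digraph \<Rightarrow> 'a set \<Rightarrow> bool" where
  "connected_in G S \<longleftrightarrow> Digraph_Component.connected (G \<restriction> S)"

text \<open>
  Vertex sets of the connected components of \<open>G[S]\<close>.  In a symmetric digraph these are the
  strongly connected components.
\<close>

definition components_in :: "('a,'b) pre_digraph \<Rightarrow> 'a set \<Rightarrow> 'a set set" where
  "components_in G S = verts ` pre_digraph.sccs (G \<restriction> S)"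

definition adjacent :: "('a,'b) pre_digraph \<Rightarrow> 'a set \<Rightarrow> 'a set \<Rightarrow> bool" where
  "adjacent G A B \<longleftrightarrow> (\<exists>x\<in>A. \<exists>y\<in>B. x \<rightarrow>\<^bsub>G\<^esub> y)"

definition adjacent_at :: "('a,'b) pre_digraph \<Rightarrow> 'a set \<Rightarrow> 'a set \<Rightarrow> 'a \<Rightarrow> bool" where
  "adjacent_at G A B v \<longleftrightarrow>
     adjacent G A B \<and> v \<in> B \<and> (\<forall>x\<in>A. \<forall>y\<in>B. x \<rightarrow>\<^bsub>G\<^esub> y \<longrightarrow> v \<in> {x, y})"

text \<open>Non-emptiness and disjointness of the parts are included in \<^const>\<open>partition_on\<close>.\<close>

definition feasible_tetrapartition :: "('a,'b) pre_digraph \<Rightarrow> 'a set set \<Rightarrow> bool" where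
  "feasible_tetrapartition G P \<longleftrightarrow>
     partition_on (verts G) P \<and> card P = 4 \<and> (\<forall>A\<in>P. connected_in G A)"

definition OPT :: "('a,'b) pre_digraph \<Rightarrow> nat" where
  "OPT G = Min ((\<lambda>P. Max (card ` P)) ` {P. feasible_tetrapartition G P})"

text \<open>
  In the following two definitions \<open>V 1, V 2, V 3, V 4\<close> are the parts of a feasible
  tetrapartition, sorted by size, with \<open>card (V 4) > 2/5 * card (verts G)\<close>; these
  conditions are not repeated.
\<close>

definition merge_applicable :: "('a,'b) pre_digraph \<Rightarrow> (nat \<Rightarrow> 'a set) \<Rightarrow> bool" where
  "merge_applicable G V \<longleftrightarrow>
     (\<exists>i\<in>{1, 2, 3}. \<exists>j\<in>{1, 2, 3}. i \<noteq> j \<and> adjacent G (V i) (V j) \<and>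
        card (V i) + card (V j) < card (V 4))"

definition pull_applicable :: "('a,'b) pre_digraph \<Rightarrow> (nat \<Rightarrow> 'a set) \<Rightarrow> bool" where
  "pull_applicable G V \<longleftrightarrow> \<not> merge_applicable G V \<and>
     (\<exists>(i, j) \<in> {(1, 3), (1, 4), (2, 3), (2, 4), (3, 4)}. \<exists>U. U \<noteq> {} \<and> U \<subset> V j \<and>
        connected_in G U \<and> connected_in G (V j - U) \<and> adjacent G U (V i) \<and>
        card (V i) + card U < card (V j))"

end

theory Submission
  imports Defs
begin

text \<open>
  Put \<open>m = |V\<^sub>4|\<close> and suppose that some feasible tetrapartition has all parts smaller than
  \<open>13/24 m\<close>.  As \<open>n > 2 m\<close>, all its parts are larger than \<open>9/24 m\<close>, hence larger than \<open>V\<^sub>1\<close> and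
  \<open>V\<^sub>2\<close>.  A component \<open>C\<close> of \<open>G[V\<^sub>3 - v]\<close> has a connected complement in \<open>V\<^sub>3\<close>, so, no Pull being
  applicable, \<open>|C| \<le> |V\<^sub>i|\<close> and \<open>C\<close> is not adjacent to \<open>V\<^sub>j\<close>.  Therefore the part containing \<open>v\<close>
  swallows every component of \<open>G[(V\<^sub>3 \<union> V\<^sub>i) - v]\<close> that is not adjacent to \<open>V\<^sub>4\<close>: any other part
  meeting such a component would be confined to it.  So this part has at least
  \<open>|V\<^sub>3| + |V\<^sub>i| - |V'\<^sub>3|\<close> vertices, and \<open>|V\<^sub>3| + |V\<^sub>i| \<ge> m\<close> because no Merge is applicable.
  The argument for \<open>u\<close> and \<open>V'\<^sub>4\<close> is the same with \<open>(V\<^sub>4, V\<^sub>j)\<close> in place of \<open>(V\<^sub>3, V\<^sub>i)\<close>.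
\<close>

section \<open>Connectedness, components and their absorption by a part\<close>

lemma dominates_induce_subgraph_iff:
  "x \<rightarrow>\<^bsub>G \<restriction> S\<^esub> y \<longleftrightarrow> x \<in> S \<and> y \<in> S \<and> x \<rightarrow>\<^bsub>G\<^esub> y"
  by (auto simp: arcs_ends_def arc_to_ends_def)

context sym_digraph
begin

lemma sym_digraph_induce_subgraph:
  "sym_digraph (G \<restriction> S)"
proof -
  have "symmetric (G \<restriction> S)"
    using graph_symmetric
    by (auto simp: symmetric_def dominates_induce_subgraph_iff intro!: symI)
  with wellformed_induce_subgraph[of S] show ?thesis
    by (simp add: sym_digraph_def sym_digraph_axioms_def)
qed

text \<open>The library's \<open>connected\<close> means reachability in the symmetric closure,
  which for a symmetric digraph is reachability itself.\<close>

lemma connected_in_iff_reachable: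
  "connected_in G S \<longleftrightarrow> S \<noteq> {} \<and> (\<forall>x\<in>S. \<forall>y\<in>S. x \<rightarrow>\<^sup>*\<^bsub>G \<restriction> S\<^esub> y)"
proof -
  interpret H: sym_digraph "G \<restriction> S" by (rule sym_digraph_induce_subgraph)
  have "Digraph_Component.connected (G \<restriction> S) \<longleftrightarrow> strongly_connected (G \<restriction> S)"
    by (simp add: Digraph_Component.connected_def strongly_connected_def
        H.reachable_mk_symmetric_eq[OF H.sym_arcs])
  then show ?thesis by (simp add: connected_in_def strongly_connected_def)
qed

text \<open>A set that no edge leaves inside \<open>S\<close> absorbs whatever its points reach, and
  the points reachable from \<open>x\<close> form such a set. With this cut form the absorption
  argument never handles walks.\<close>

lemma connected_in_iff_cut:
  "connected_in G S \<longleftrightarrow>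
    S \<noteq> {} \<and> (\<forall>A. A \<subseteq> S \<longrightarrow> A \<noteq> {} \<longrightarrow> \<not> adjacent G A (S - A) \<longrightarrow> A = S)"
    (is "_ \<longleftrightarrow> _ \<and> ?cut")
proof -
  interpret H: sym_digraph "G \<restriction> S" by (rule sym_digraph_induce_subgraph)
  have "(\<forall>x\<in>S. \<forall>y\<in>S. x \<rightarrow>\<^sup>*\<^bsub>G \<restriction> S\<^esub> y) \<longleftrightarrow> ?cut"
  proof
    assume reach: "\<forall>x\<in>S. \<forall>y\<in>S. x \<rightarrow>\<^sup>*\<^bsub>G \<restriction> S\<^esub> y"
    show ?cut
    proof (intro allI impI)
      fix A assume A: "A \<subseteq> S" "A \<noteq> {}" "\<not> adjacent G A (S - A)"
      then obtain x where x: "x \<in> A" by blast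
      have "y \<in> A" if "x \<rightarrow>\<^sup>*\<^bsub>G \<restriction> S\<^esub> y" for y
        using that
      proof (induction rule: H.reachable_induct)
        case base
        then show ?case using x by simp
      next
        case (step y z)
        then show ?case using A(3)
          by (auto simp: adjacent_def dominates_induce_subgraph_iff)
      qed
      with reach x A(1) show "A = S" by blast
    qed
  next
    assume cut: ?cut
    show "\<forall>x\<in>S. \<forall>y\<in>S. x \<rightarrow>\<^sup>*\<^bsub>G \<restriction> S\<^esub> y"
    proof
      fix x assume x: "x \<in> S"
      let ?A = "{y \<in> S. x \<rightarrow>\<^sup>*\<^bsub>G \<restriction> S\<^esub> y}"
      have "?A \<noteq> {}" using x by auto
      moreover have "\<not> adjacent G ?A (S - ?A)"
        using H.reachable_adj_trans
        by (fastforce simp: adjacent_def dominates_induce_subgraph_iff)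
      ultimately have "?A = S" using cut by simp
      then show "\<forall>y\<in>S. x \<rightarrow>\<^sup>*\<^bsub>G \<restriction> S\<^esub> y" by blast
    qed
  qed
  then show ?thesis using connected_in_iff_reachable by simp
qed

lemma connected_in_cutD:
  assumes "connected_in G S" "A \<subseteq> S" "A \<noteq> {}" "\<not> adjacent G A (S - A)"
  shows "A = S"
  using assms connected_in_iff_cut by blast

lemma components_in_conv:
  "components_in G S = pre_digraph.sccs_verts (G \<restriction> S)"
proof -
  interpret H: sym_digraph "G \<restriction> S" by (rule sym_digraph_induce_subgraph)
  show ?thesis by (simp add: components_in_def H.sccs_verts_conv)
qed

lemma adjacent_commute: "adjacent G A B \<longleftrightarrow> adjacent G B A"
  using graph_symmetric by (auto simp: adjacent_def)

lemma component_cover: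
  assumes "x \<in> S"
  obtains C where "C \<in> components_in G S" "x \<in> C"
proof -
  interpret H: sym_digraph "G \<restriction> S" by (rule sym_digraph_induce_subgraph)
  have "{y. x \<rightarrow>\<^sup>*\<^bsub>G \<restriction> S\<^esub> y} \<in> components_in G S"
    using imageI[OF H.induce_reachable_is_in_sccs, of x verts] assms
    by (simp add: components_in_def)
  with assms that show thesis by simp
qed

text \<open>Components are classes of reachability in \<open>G[S]\<close>, so connectedness of
  \<open>G[C]\<close> itself needs an argument: since no edge leaves \<open>C\<close> within
  \<open>S\<close>, a walk starting in \<open>C\<close> stays there, and a subset of
  \<open>C\<close> without edges to the rest of \<open>C\<close> is closed under
  reachability.\<close>

lemma componentD:
  assumes C: "C \<in> components_in G S"
  shows "C \<subseteq> S" and "connected_in G C" and "\<not> adjacent G C (S - C)"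
proof -
  interpret H: sym_digraph "G \<restriction> S" by (rule sym_digraph_induce_subgraph)
  have scc: "C \<in> H.sccs_verts" using components_in_conv C by simp
  show CS: "C \<subseteq> S"
  proof
    fix x assume "x \<in> C"
    then have "x \<rightarrow>\<^sup>*\<^bsub>G \<restriction> S\<^esub> x" using scc unfolding H.in_sccs_verts_conv_reachable by metis
    then show "x \<in> S" using H.reachable_in_verts(1) by fastforce
  qed
  show nadj: "\<not> adjacent G C (S - C)"
  proof
    assume "adjacent G C (S - C)"
    then obtain x y where xy: "x \<in> C" "y \<in> S - C" "x \<rightarrow>\<^bsub>G\<^esub> y"
      by (auto simp: adjacent_def)
    then have "x \<rightarrow>\<^sup>*\<^bsub>G \<restriction> S\<^esub> y" "y \<rightarrow>\<^sup>*\<^bsub>G \<restriction> S\<^esub> x"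
      using CS graph_symmetric by (auto simp: dominates_induce_subgraph_iff intro!: H.reachable_adjI)
    with xy scc show False unfolding H.in_sccs_verts_conv_reachable by blast
  qed
  have "A = C" if A: "A \<subseteq> C" "A \<noteq> {}" "\<not> adjacent G A (C - A)" for A
  proof -
    obtain x where x: "x \<in> A" using A by blast
    have "y \<in> A" if "x \<rightarrow>\<^sup>*\<^bsub>G \<restriction> S\<^esub> y" for y
      using that
    proof (induction rule: H.reachable_induct)
      case base
      then show ?case using x by simp
    next
      case (step y z)
      then have "z \<in> C"
        using A(1) nadj by (auto simp: adjacent_def dominates_induce_subgraph_iff)
      with step A(3) show ?case
        by (auto simp: adjacent_def dominates_induce_subgraph_iff)
    qed
    then have "C \<subseteq> A" using x A(1) scc unfolding H.in_sccs_verts_conv_reachable by blast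
    with A(1) show ?thesis by blast
  qed
  moreover have "C \<noteq> {}" using scc unfolding H.in_sccs_verts_conv_reachable by blast
  ultimately show "connected_in G C"
    using connected_in_iff_cut[of C] by blast
qed

text \<open>Consider a cut of \<open>X - C\<close> without crossing edges. A side avoiding
  \<open>w\<close> has no edge to \<open>C\<close> either, so it would be cut off in the connected
  \<open>X\<close>. Hence both sides would have to contain \<open>w\<close>.\<close>

lemma connected_in_complement:
  assumes X: "connected_in G X" and w: "w \<in> X"
    and C: "C \<subseteq> X - {w}" "\<not> adjacent G C (X - {w} - C)"
  shows "connected_in G (X - C)"
proof -
  have side: "w \<in> A" if "A \<subseteq> X - C" "A \<noteq> {}" "\<not> adjacent G A (X - C - A)" for A
  proof (rule ccontr)
    assume "w \<notin> A"
    then have "\<not> adjacent G C A"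
      using that(1) C(2) by (auto simp: adjacent_def)
    then have "\<not> adjacent G A (X - A)"
      using that(3) adjacent_commute[of C A] unfolding adjacent_def by blast
    then have "A = X" using connected_in_cutD[OF X] that by blast
    with w \<open>w \<notin> A\<close> show False by blast
  qed
  have "A = X - C" if A: "A \<subseteq> X - C" "A \<noteq> {}" "\<not> adjacent G A (X - C - A)" for A
  proof (rule ccontr)
    assume "A \<noteq> X - C"
    then have "X - C - A \<noteq> {}" using A(1) by blast
    moreover have "X - C - (X - C - A) = A" using A(1) by blast
    ultimately have "w \<in> X - C - A"
      using side[of "X - C - A"] A(3) adjacent_commute[of A] by auto
    with side[OF A] show False by blast
  qed
  moreover have "X - C \<noteq> {}" using w C(1) by blast
  ultimately show ?thesis using connected_in_iff_cut[of "X - C"] by blast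
qed

text \<open>
  Here \<open>X\<close> is the large part whose attachment vertex \<open>w\<close> is considered, \<open>Y\<close> the small part
  attached to it, \<open>Z\<close> the other small part and \<open>T\<close> the other large one; \<open>pullY\<close> and \<open>pullZ\<close>
  say that no Pull moves a piece of \<open>X\<close> to \<open>Y\<close> or \<open>Z\<close>.
\<close>

lemma part_absorbs_components:
  assumes XY: "verts G = X \<union> Y \<union> Z \<union> T" "X \<inter> Y = {}"
    and fin: "finite (verts G)"
    and conn: "connected_in G X"
    and att: "adjacent_at G Y X w"
    and nYZ: "\<not> adjacent G Y Z"
    and pullY: "\<And>U. \<lbrakk>U \<noteq> {}; U \<subset> X; connected_in G U; connected_in G (X - U);
        adjacent G U Y\<rbrakk> \<Longrightarrow> card X \<le> card Y + card U"
    and pullZ: "\<And>U. \<lbrakk>U \<noteq> {}; U \<subset> X; connected_in G U; connected_in G (X - U);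
        adjacent G U Z\<rbrakk> \<Longrightarrow> card X \<le> card Z + card U"
    and small: "card Y + card Z < card X"
    and P: "partition_on (verts G) P" "\<And>Q. Q \<in> P \<Longrightarrow> connected_in G Q"
      "\<And>Q. Q \<in> P \<Longrightarrow> card Y < card Q"
  shows "\<exists>Q\<in>P. X \<union> Y - \<Union>{C \<in> components_in G (X \<union> Y - {w}). adjacent G C T} \<subseteq> Q"
proof -
  have wX: "w \<in> X" and adjYX: "adjacent G Y X"
    and at: "\<And>x y. x \<in> Y \<Longrightarrow> y \<in> X \<Longrightarrow> x \<rightarrow>\<^bsub>G\<^esub> y \<Longrightarrow> y = w"
    using att XY(2) by (auto simp: adjacent_at_def)
  have at': "\<not> adjacent G Y (X - {w})" using at by (auto simp: adjacent_def)
  obtain y where y: "y \<in> Y" "y \<rightarrow>\<^bsub>G\<^esub> w" using adjYX at by (auto simp: adjacent_def)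
  have wY: "w \<rightarrow>\<^bsub>G\<^esub> y" using y graph_symmetric by blast
  have sub: "X \<subseteq> verts G" "Y \<subseteq> verts G" "X \<union> Y - {w} \<subseteq> verts G" using XY(1) by auto
  have finX: "finite X" "finite Y" using sub fin finite_subset by blast+
  obtain Q where Q: "Q \<in> P" "w \<in> Q" using P(1) wX sub(1) by (auto simp: partition_on_def)
  have small_comp: "card C \<le> card Y \<and> \<not> adjacent G C Z"
    if C: "C \<in> components_in G (X \<union> Y - {w})" for C
  proof -
    note D = componentD[OF C]
    have Cne: "C \<noteq> {}" using D(2) connected_in_iff_cut by blast
    show ?thesis
    proof (cases "C \<inter> Y = {}")
      case True
      then have CX: "C \<subseteq> X - {w}" using D(1) by blast
      have "\<not> adjacent G C (X - {w} - C)" using D(3) by (auto simp: adjacent_def)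
      then have comp: "connected_in G (X - C)"
        using connected_in_complement[OF conn wX CX] by blast
      \<comment> \<open>The Pull to test moves \<open>X - C\<close>, which has an edge to
        \<open>Y\<close> at \<open>w\<close>, and leaves \<open>C\<close> behind. Its failure bounds
        \<open>card C\<close> by \<open>card Y\<close>.\<close>
      have "adjacent G (X - C) Y" using wX wY y(1) CX by (auto simp: adjacent_def)
      moreover have "X - (X - C) = C" using CX by blast
      ultimately have "card X \<le> card Y + card (X - C)"
        using pullY[of "X - C"] comp D(2) Cne wX CX by auto
      moreover have "card (X - C) + card C = card X"
        using CX finX(1) by (metis Diff_subset add.commute card_Diff_subset card_mono finite_subset
            le_add_diff_inverse subset_trans)
      ultimately have le: "card C \<le> card Y" by linarith
      \<comment> \<open>Otherwise \<open>C\<close> could be pulled to \<open>Z\<close>: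
        \<open>card Z + card C\<close> is at most \<open>card Z + card Y\<close>, which is below
        \<open>card X\<close>.\<close>
      moreover have "\<not> adjacent G C Z"
      proof
        assume "adjacent G C Z"
        then have "card X \<le> card Z + card C"
          using pullZ[of C] Cne CX wX D(2) comp by blast
        with le small show False by linarith
      qed
      ultimately show ?thesis by blast
    next
      case False
      \<comment> \<open>All edges between \<open>Y\<close> and \<open>X\<close> end at the deleted
        \<open>w\<close>, so a component meeting \<open>Y\<close> lies inside
        \<open>Y\<close>.\<close>
      have "\<not> adjacent G (C \<inter> Y) (C - C \<inter> Y)"
        using at' D(1) by (auto simp: adjacent_def)
      then have "C \<inter> Y = C" using connected_in_cutD[OF D(2)] False by blast
      then have "C \<subseteq> Y" by blast
      then show ?thesis using nYZ card_mono[OF finX(2)] by (auto simp: adjacent_def)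
    qed
  qed
  have "x \<in> Q" if x: "x \<in> X \<union> Y"
    and nx: "x \<notin> \<Union>{C \<in> components_in G (X \<union> Y - {w}). adjacent G C T}" for x
  proof (rule ccontr)
    assume xQ: "x \<notin> Q"
    with Q x have "x \<in> X \<union> Y - {w}" by blast
    then obtain C where C: "C \<in> components_in G (X \<union> Y - {w})" "x \<in> C"
      by (rule component_cover)
    note D = componentD[OF C(1)]
    have nT: "\<not> adjacent G C T" using nx C by blast
    have "x \<in> \<Union>P" using x sub(1,2) partition_onD1[OF P(1)] by blast
    then obtain R where R: "R \<in> P" "x \<in> R" by blast
    have "w \<notin> R" using P(1) Q R xQ by (auto simp: partition_on_def disjoint_def)
    have Rv: "R \<subseteq> verts G" using P(1) R by (auto simp: partition_on_def)
    \<comment> \<open>The only exits from \<open>C\<close> are through \<open>w\<close>, which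
      \<open>R\<close> misses: edges to other components, to \<open>Z\<close> and to
      \<open>T\<close> are all excluded. So \<open>R\<close> is confined to \<open>C\<close> and is
      too small.\<close>
    have "\<not> adjacent G (R \<inter> C) (R - R \<inter> C)"
    proof
      assume "adjacent G (R \<inter> C) (R - R \<inter> C)"
      then obtain a b where ab: "a \<in> C" "b \<in> R" "b \<notin> C" "a \<rightarrow>\<^bsub>G\<^esub> b"
        by (auto simp: adjacent_def)
      then have "b \<in> (X \<union> Y - {w} - C) \<union> Z \<union> T" using Rv XY(1) \<open>w \<notin> R\<close> by blast
      then show False using D(3) nT small_comp[OF C(1)] ab by (auto simp: adjacent_def)
    qed
    then have "R \<inter> C = R" using connected_in_cutD[OF P(2)[OF R(1)]] R C by blast
    then have "card R \<le> card C"
      using D(1) sub(3) fin by (metis card_mono finite_subset inf.orderI)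
    then show False using small_comp[OF C(1)] P(3)[OF R(1)] by linarith
  qed
  then show ?thesis using Q(1) by blast
qed

end

section \<open>Optimal tetrapartitions and the sizes of their parts\<close>

lemma OPT_attained:
  assumes "finite (verts G)" "feasible_tetrapartition G P0"
  obtains P where "feasible_tetrapartition G P" "\<And>Q. Q \<in> P \<Longrightarrow> card Q \<le> OPT G"
proof -
  have "{P. feasible_tetrapartition G P} \<subseteq> Pow (Pow (verts G))"
    by (auto simp: feasible_tetrapartition_def partition_on_def)
  then have "finite {P. feasible_tetrapartition G P}"
    using assms(1) by (simp add: finite_subset)
  \<comment> \<open>\<open>P0\<close> makes the set non-empty; \<open>Min\<close> of the empty set
    would be unspecified.\<close>
  then have "OPT G \<in> (\<lambda>P. Max (card ` P)) ` {P. feasible_tetrapartition G P}"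
    unfolding OPT_def using assms(2) by (intro Min_in) auto
  then obtain P where P: "feasible_tetrapartition G P" "OPT G = Max (card ` P)" by blast
  have "finite P"
    using P(1) by (intro card_ge_0_finite) (simp add: feasible_tetrapartition_def)
  with P that show thesis by simp
qed

text \<open>This turns an upper bound on all parts into a lower bound on each: the other three hold
  at most \<open>3 * k\<close> elements.\<close>

lemma card_le_three_parts:
  assumes "finite A" "partition_on A P" "card P = 4" "\<And>Q. Q \<in> P \<Longrightarrow> card Q \<le> k" "Q \<in> P"
  shows "card A \<le> card Q + 3 * k"
proof -
  have finP: "finite P" using assms(3) by (intro card_ge_0_finite) simp
  have "card A = (\<Sum>R\<in>P. card R)"
    using assms(1,2) by (intro product_partition) (auto simp: partition_on_def intro: finite_subset)
  also have "\<dots> = card Q + (\<Sum>R\<in>P - {Q}. card R)"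
    using assms(5) finP by (simp add: sum.remove)
  also have "(\<Sum>R\<in>P - {Q}. card R) \<le> of_nat (card (P - {Q})) * k"
    using assms(4) by (intro sum_bounded_above) auto
  finally show ?thesis using assms(3,5) finP by simp
qed

theorem theorem7:
  fixes G :: "('a,'b) pre_digraph" and V :: "nat \<Rightarrow> 'a set" and n i j :: nat and u v :: 'a
  assumes "graph G" and "Digraph_Component.connected G"
    and "n = card (verts G)"
    and "feasible_tetrapartition G {V 1, V 2, V 3, V 4}"
    and "card (V 1) \<le> card (V 2)" and "card (V 2) \<le> card (V 3)" and "card (V 3) \<le> card (V 4)"
    and "real (card (V 4)) > 2/5 * real n"
    and "\<not> merge_applicable G V" and "\<not> pull_applicable G V"
    and "card (V 2) + card (V 3) \<ge> card (V 4)"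
    and "real (card (V 4)) < 1/2 * real n"
    and "real (card (V 2)) < 1/6 * real (card (V 4))"
    and "1/6 * real (card (V 4)) < 1/12 * real n"
    and "real (card (V 3)) > 1/3 * real n"
    and "i \<in> {1, 2}" and "j = 3 - i"
    and "adjacent_at G (V i) (V 3) v"
    and "adjacent_at G (V j) (V 4) u"
  shows "(let V3' = \<Union>{C \<in> components_in G ((V 3 \<union> V i) - {v}). adjacent G C (V 4)} in
            real (card V3') \<le> real (card (V i)) + 7/24 * real (card (V 4)) \<longrightarrow>
            real (card (V 4)) \<le> 24/13 * real (OPT G)) \<and>
         (let V4' = \<Union>{C \<in> components_in G ((V 4 \<union> V j) - {u}). adjacent G C (V 3)} in
            real (card V4') \<le> real (card (V j)) + 11/24 * real (card (V 4)) \<longrightarrow>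
            real (card (V 4)) \<le> 24/13 * real (OPT G))"
proof -
  interpret G: graph G by (rule assms(1))
  let ?m = "card (V 4)" and ?P0 = "{V 1, V 2, V 3, V 4}"
  note feas = assms(4)
  have part: "partition_on (verts G) ?P0" and four: "card ?P0 = 4"
    and conn: "connected_in G (V 1)" "connected_in G (V 2)" "connected_in G (V 3)"
      "connected_in G (V 4)"
    using feas by (auto simp: feasible_tetrapartition_def)
  \<comment> \<open>The parts are given as a set, so it is the cardinality 4 that makes different
    indices denote different, hence disjoint, parts.\<close>
  have dist: "V 3 \<noteq> V 1" "V 3 \<noteq> V 2" "V 4 \<noteq> V 1" "V 4 \<noteq> V 2"
    using four by (auto simp: card_insert_if split: if_splits)
  have disj: "V b \<inter> V a = {}" if "a \<in> {1, 2}" "b \<in> {3, 4}" for a b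
  proof -
    have "V b \<in> ?P0" "V a \<in> ?P0" "V b \<noteq> V a" using that dist by auto
    then show ?thesis by (rule disjointD[OF partition_onD2[OF part]])
  qed
  have un: "verts G = V 1 \<union> V 2 \<union> V 3 \<union> V 4"
    using part by (auto simp: partition_on_def)
  have finV: "finite (V 1)" "finite (V 2)" "finite (V 3)" "finite (V 4)"
    using un G.finite_verts by (auto intro: finite_subset)
  have ij: "i = 1 \<and> j = 2 \<or> i = 2 \<and> j = 1" using assms(16,17) by auto
  have sm: "6 * card (V i) < ?m" "6 * card (V j) < ?m"
    using ij assms(5,13) by auto
  have nm: "\<not> adjacent G (V a) (V b) \<or> ?m \<le> card (V a) + card (V b)"
    if "a \<in> {1, 2, 3}" "b \<in> {1, 2, 3}" "a \<noteq> b" for a b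
    using assms(9) that unfolding merge_applicable_def by (meson not_le)
  have pull: "card (V b) \<le> card (V a) + card U"
    if "a \<in> {1, 2}" "b \<in> {3, 4}" "U \<noteq> {}" "U \<subset> V b" "connected_in G U"
      "connected_in G (V b - U)" "adjacent G U (V a)" for a b U
  proof (rule ccontr)
    assume "\<not> ?thesis"
    then have "card (V a) + card U < card (V b)" by simp
    moreover have "(a, b) \<in> {(1, 3), (1, 4), (2, 3), (2, 4), (3, 4)}" using that by auto
    ultimately show False
      using assms(9,10) that unfolding pull_applicable_def by blast
  qed
  have ne: "i \<in> {1, 2}" "j \<in> {1, 2}" "i \<noteq> j" using ij by auto
  have nij: "\<not> adjacent G (V i) (V j)" "\<not> adjacent G (V j) (V i)"
    using nm[of i j] nm[of j i] ne sm by auto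
  have V3: "?m \<le> card (V i) + card (V 3)"
    using nm[of i 3] ij assms(18) by (auto simp: adjacent_at_def)
  obtain P where P: "feasible_tetrapartition G P" "\<And>Q. Q \<in> P \<Longrightarrow> card Q \<le> OPT G"
    using OPT_attained[OF G.finite_verts feas] by blast
  have Pp: "partition_on (verts G) P" "card P = 4" "\<And>Q. Q \<in> P \<Longrightarrow> connected_in G Q"
    using P(1) by (auto simp: feasible_tetrapartition_def)
  \<comment> \<open>Both claims are instances, with \<open>(b, a, w)\<close> equal to
    \<open>(3, i, v)\<close> and \<open>(4, j, u)\<close>.\<close>
  have bound: "real ?m \<le> 24/13 * real (OPT G)"
    if X: "b \<in> {3, 4}" "a \<in> {1, 2}" "c \<in> {1, 2}" "a \<noteq> c" "d \<in> {3, 4}" "b \<noteq> d"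
      and att: "adjacent_at G (V a) (V b) w"
      and big: "real (card (V b)) + real (card (V a)) -
        real (card (\<Union>{C \<in> components_in G (V b \<union> V a - {w}). adjacent G C (V d)})) \<ge> 13/24 * ?m"
    for a b c d w
  proof (rule ccontr)
    assume "\<not> ?thesis"
    then have opt: "24 * OPT G < 13 * ?m" by simp
    let ?W = "\<Union>{C \<in> components_in G (V b \<union> V a - {w}). adjacent G C (V d)}"
    have ac: "a = i \<and> c = j \<or> a = j \<and> c = i" using X ne by auto
    have smac: "6 * card (V a) < ?m" "6 * card (V c) < ?m" using ac sm by auto
    have Qbig: "card (V a) < card Q" if "Q \<in> P" for Q
    proof -
      have "n \<le> card Q + 3 * OPT G"
        using card_le_three_parts[OF G.finite_verts Pp(1,2) P(2) that] assms(3) by simp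
      moreover have "2 * ?m < n" using assms(12) by simp
      \<comment> \<open>The margin is 2 - 3 * 13/24 = 9/24, above 1/6.\<close>
      ultimately show ?thesis using opt smac by linarith
    qed
    have uni: "verts G = V b \<union> V a \<union> V c \<union> V d" using un X by auto
    have "V b \<inter> V a = {}" by (rule disj[OF X(2,1)])
    \<comment> \<open>As \<open>6 * card (V i) < ?m\<close>, this puts \<open>card (V b)\<close>
      above 5/6 of \<open>?m\<close>, while \<open>V a\<close> and \<open>V c\<close> together stay
      below 1/3 of it.\<close>
    have Vb: "?m \<le> card (V i) + card (V b)" using X V3 by auto
    have "\<exists>Q\<in>P. V b \<union> V a - ?W \<subseteq> Q"
    proof (rule G.part_absorbs_components[OF uni \<open>V b \<inter> V a = {}\<close> G.finite_verts])
      show "connected_in G (V b)" using X conn by auto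
      show "adjacent_at G (V a) (V b) w" by (rule att)
      show "\<not> adjacent G (V a) (V c)" using nij ac by auto
      show "card (V a) + card (V c) < card (V b)" using sm smac Vb by linarith
    qed (use pull X Pp Qbig in blast)+
    then obtain Q where Q: "Q \<in> P" "V b \<union> V a - ?W \<subseteq> Q" by blast
    have finQ: "finite Q" using Q Pp(1) G.finite_verts
      by (metis Union_upper finite_subset partition_onD1)
    have finW: "finite ?W"
    proof (rule finite_subset)
      have "V b \<union> V a - {w} \<subseteq> verts G" using uni by blast
      then show "?W \<subseteq> V b \<union> V a" using G.componentD(1) by blast
      show "finite (V b \<union> V a)" using X finV by auto
    qed
    have "card (V b) + card (V a) = card (V b \<union> V a)"
      using \<open>V b \<inter> V a = {}\<close> X finV by (subst card_Un_disjoint) auto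
    also have "\<dots> \<le> card ?W + card (V b \<union> V a - ?W)"
      using diff_card_le_card_Diff[OF finW, of "V b \<union> V a"] by linarith
    also have "card (V b \<union> V a - ?W) \<le> OPT G"
      using card_mono[OF finQ Q(2)] P(2)[OF Q(1)] by linarith
    finally show False using big opt by simp
  qed
  show ?thesis
    unfolding Let_def
  proof (intro conjI impI)
    assume "real (card (\<Union>{C \<in> components_in G (V 3 \<union> V i - {v}). adjacent G C (V 4)}))
      \<le> real (card (V i)) + 7/24 * real ?m"
    \<comment> \<open>\<open>V3\<close> and \<open>sm\<close> give \<open>card (V 3)\<close> above
      5/6 of \<open>?m\<close>, and 5/6 - 7/24 = 13/24.\<close>
    then show "real ?m \<le> 24/13 * real (OPT G)"
      using V3 sm ne by (intro bound[OF _ _ _ _ _ _ assms(18), of j 4]) auto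
  next
    assume "real (card (\<Union>{C \<in> components_in G (V 4 \<union> V j - {u}). adjacent G C (V 3)}))
      \<le> real (card (V j)) + 11/24 * real ?m"
    \<comment> \<open>Here the large part has size \<open>?m\<close> itself, and 1 - 11/24 =
      13/24.\<close>
    then show "real ?m \<le> 24/13 * real (OPT G)"
      using ne by (intro bound[OF _ _ _ _ _ _ assms(19), of i 3]) auto
  qed
qed

end
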